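(* Let $L\subseteq E$ be a linear subspace such that $L\cap\operatorname{int}(K)\neq\emptyset$. (a) For any norm $\|\cdot\|$ in $E$, $$1\le \min_{\substack{v\in K,\ u\in K^*\\ \|v\|=1,\ \langle u,v\rangle=1}}\|u\|^*\le\frac{\sigma(L)}{\nu(L)}\le\frac{1}{\displaystyle\min_{\substack{u\in K^*\\ \|u\|^*=1}}\ \max_{\substack{v\in K\\ \|v\|=1}}\langle u,v\rangle}.$$ (b) If $\|\cdot\|=\|\cdot\|_2$ then $$1\le\frac{\sigma(L)}{\nu(L)}\le\frac{1}{\cos(\Theta(K^*,K))},\qquad\text{where}\quad \Theta(K^*,K):=\max_{u\in K^*\setminus\{0\}}\ \min_{v\in K\setminus\{0\}}\angle(u,v).$$ In particular, if $K^*\subseteq K$ then $\nu(L)=\sigma(L)$. (c) If $\|\cdot\|=\|\cdot\|_e$ then $\sigma(L)=\nu(L)$.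
   Context: $E\neq\{0\}$ is a finite-dimensional real inner product space with inner product $\langle\cdot,\cdot\rangle$, endowed with a norm $\|\cdot\|$ (not necessarily Euclidean); the dual norm is $\|u\|^*:=\max_{\|x\|=1}\langle u,x\rangle$. $\|v\|_2:=\sqrt{\langle v,v\rangle}$, and for nonzero $x,y$, $\angle(x,y):=\arccos\frac{\langle x,y\rangle}{\|x\|_2\|y\|_2}\in[0,\pi]$. $K\subseteq E$ is a regular closed convex cone ($\operatorname{int}(K)\neq\emptyset$ and $K$ contains no lines), with dual cone $K^*:=\{u\in E:\langle u,x\rangle\ge 0\ \forall x\in K\}$. $e\in\operatorname{int}(K)$ is fixed and $$\|x\|_e:=\min\{\alpha\ge 0: x+\alpha e\in K,\ -x+\alpha e\in K\}.$$ For a linear subspace $L\subseteq E$ with orthogonal complement $L^\perp$, $$\nu(L):=\min_{u\in K^*,\,y\in L^\perp,\,\|u\|^*=1}\|u-y\|^*.$$ For $v\in K\setminus\{0\}$, $\lambda_v:E\to[-\infty,\infty)$ is $\lambda_v(x):=\max\{t\in\mathbb R: x-tv\in K\}$ (equal to $-\infty$ if no such $t$ exists). The sigma measure of $L$ is $$\sigma(L):=\min_{v\in K,\,\|v\|=1}\ \max_{x\in L,\,\|x\|\le 1}\lambda_v(x).$$ *)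

theory Defs
  imports "HOL-Analysis.Analysis"
begin

text \<open>
  The ambient space is a type of class \<^class>\<open>euclidean_space\<close>: a nonzero finite-dimensional real
  inner product space whose built-in \<^const>\<open>norm\<close> is the inner product norm. A second, arbitrary
  norm on that space is an explicit function \<open>N\<close>.
\<close>

definition is_norm :: "('a::real_vector \<Rightarrow> real) \<Rightarrow> bool" where
  "is_norm N \<longleftrightarrow>
     (\<forall>x. 0 \<le> N x) \<and>
     (\<forall>x. N x = 0 \<longleftrightarrow> x = 0) \<and>
     (\<forall>a x. N (a *\<^sub>R x) = \<bar>a\<bar> * N x) \<and>
     (\<forall>x y. N (x + y) \<le> N x + N y)"

text \<open>
  Genuine (attained) maxima and minima over possibly infinite sets, as opposed to
  \<^const>\<open>Sup\<close> and \<^const>\<open>Inf\<close>. When the extremum is not attained the value is unspecified.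
\<close>

definition max_on :: "'b set \<Rightarrow> ('b \<Rightarrow> 'c::order) \<Rightarrow> 'c" where
  "max_on S f = (GREATEST t. t \<in> f ` S)"

definition min_on :: "'b set \<Rightarrow> ('b \<Rightarrow> 'c::order) \<Rightarrow> 'c" where
  "min_on S f = (LEAST t. t \<in> f ` S)"

definition dual_norm :: "('a::real_inner \<Rightarrow> real) \<Rightarrow> 'a \<Rightarrow> real" where
  "dual_norm N u = max_on {x. N x = 1} (\<lambda>x. u \<bullet> x)"

definition angle :: "'a::real_inner \<Rightarrow> 'a \<Rightarrow> real" where
  "angle x y = arccos ((x \<bullet> y) / (norm x * norm y))"

definition regular_cone :: "'a::real_normed_vector set \<Rightarrow> bool" where
  "regular_cone K \<longleftrightarrow>
     closed K \<and> convex_cone K \<and> interior K \<noteq> {} \<and>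
     \<not> (\<exists>x d. d \<noteq> 0 \<and> (\<forall>t. x + t *\<^sub>R d \<in> K))"

definition dual_cone :: "'a::real_inner set \<Rightarrow> 'a set" where
  "dual_cone K = {u. \<forall>x\<in>K. 0 \<le> u \<bullet> x}"

definition order_unit_norm :: "'a::real_vector set \<Rightarrow> 'a \<Rightarrow> 'a \<Rightarrow> real" where
  "order_unit_norm K e x =
     (LEAST \<alpha>. 0 \<le> \<alpha> \<and> x + \<alpha> *\<^sub>R e \<in> K \<and> - x + \<alpha> *\<^sub>R e \<in> K)"

definition nu_measure :: "('a::euclidean_space \<Rightarrow> real) \<Rightarrow> 'a set \<Rightarrow> 'a set \<Rightarrow> real" where
  "nu_measure N K L =
     min_on {(u, y). u \<in> dual_cone K \<and> y \<in> L\<^sup>\<bottom> \<and> dual_norm N u = 1}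
       (\<lambda>(u, y). dual_norm N (u - y))"

definition cone_lambda :: "'a::real_vector set \<Rightarrow> 'a \<Rightarrow> 'a \<Rightarrow> ereal" where
  "cone_lambda K v x =
     (if \<exists>t::real. x - t *\<^sub>R v \<in> K then ereal (GREATEST t. x - t *\<^sub>R v \<in> K) else -\<infinity>)"

definition sigma_measure :: "('a::real_vector \<Rightarrow> real) \<Rightarrow> 'a set \<Rightarrow> 'a set \<Rightarrow> ereal" where
  "sigma_measure N K L =
     min_on {v \<in> K. N v = 1} (\<lambda>v. max_on {x \<in> L. N x \<le> 1} (cone_lambda K v))"

definition max_min_angle :: "'a::real_inner set \<Rightarrow> 'a set \<Rightarrow> real" where
  "max_min_angle C D = max_on (C - {0}) (\<lambda>u. min_on (D - {0}) (angle u))"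

end

theory Submission
  imports Defs
begin

text \<open>
  By convex duality the inner maximum in \<open>\<sigma>(L)\<close> at \<open>v\<close> is the minimum of the dual norm of
  \<open>u - y\<close> over \<open>u \<in> K\<^sup>*\<close> with \<open>\<langle>u, v\<rangle> = 1\<close> and \<open>y \<in> L\<^sup>\<bottom>\<close>. So \<open>\<sigma>(L)\<close> and \<open>\<nu>(L)\<close> minimise the same
  positively homogeneous function of \<open>(u, y)\<close> under two different normalisations of \<open>u\<close>, and
  rescaling a minimiser of either problem gives the two bounds on the quotient. For the Euclidean
  norm the minimum over \<open>u\<close> in the upper bound is the cosine of the angle; for the order unit norm
  the dual norm of \<open>u \<in> K\<^sup>*\<close> is attained at \<open>e\<close>, which makes the upper bound equal to 1.
\<close>

subsection \<open>Attained extrema, norms and dual norms\<close>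

lemma max_on_eqI:
  assumes "x \<in> S" "\<And>y. y \<in> S \<Longrightarrow> f y \<le> f x"
  shows "max_on S f = f x"
  unfolding max_on_def by (rule Greatest_equality) (use assms in auto)

lemma min_on_eqI:
  assumes "x \<in> S" "\<And>y. y \<in> S \<Longrightarrow> f x \<le> f y"
  shows "min_on S f = f x"
  unfolding min_on_def by (rule Least_equality) (use assms in auto)

text \<open>Bounded sublevel sets replace compactness of \<open>S\<close>: a minimiser over the
  sublevel set of one point of \<open>S\<close> is global. The constraint sets below may be
  unbounded in their dual variables.\<close>

lemma min_on_attained:
  fixes f :: "'b::heine_borel \<Rightarrow> real"
  assumes "closed S" "S \<noteq> {}" "continuous_on UNIV f" "\<And>c. bounded {x \<in> S. f x \<le> c}"
  shows "\<exists>x\<in>S. min_on S f = f x \<and> (\<forall>y\<in>S. f x \<le> f y)"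
proof -
  obtain a where a: "a \<in> S" using assms(2) by auto
  let ?C = "{x \<in> S. f x \<le> f a}"
  have "?C = S \<inter> {x. f x \<le> f a}" by auto
  then have "closed ?C"
    using assms(1,3) by (simp add: closed_Int closed_Collect_le continuous_on_const)
  then have "compact ?C" using assms(4) by (simp add: compact_eq_bounded_closed)
  moreover have "?C \<noteq> {}" using a by auto
  moreover have "continuous_on ?C f" using assms(3) by (rule continuous_on_subset) simp
  ultimately have "\<exists>x\<in>?C. \<forall>y\<in>?C. f x \<le> f y" by (rule continuous_attains_inf)
  then obtain x where x: "x \<in> ?C" "\<forall>y\<in>?C. f x \<le> f y" ..
  have le: "f x \<le> f y" if "y \<in> S" for y
  proof (cases "f y \<le> f a")
    case True
    then show ?thesis using x(2) that by blast
  next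
    case False
    then show ?thesis using x(1) by simp
  qed
  have "x \<in> S" using x(1) by blast
  with min_on_eqI[of x S f, OF this le] le show ?thesis by blast
qed

lemma support_attained:
  fixes C :: "'a::euclidean_space set"
  assumes "compact C" "C \<noteq> {}"
  shows "\<exists>x\<in>C. max_on C (\<lambda>x. u \<bullet> x) = u \<bullet> x \<and> (\<forall>y\<in>C. u \<bullet> y \<le> u \<bullet> x)"
proof -
  have "continuous_on C (\<lambda>x. u \<bullet> x)" by (intro continuous_intros)
  with assms have "\<exists>x\<in>C. \<forall>y\<in>C. u \<bullet> y \<le> u \<bullet> x" by (rule continuous_attains_sup)
  then obtain x where x: "x \<in> C" "\<forall>y\<in>C. u \<bullet> y \<le> u \<bullet> x" ..
  with max_on_eqI[of x C "\<lambda>x. u \<bullet> x"] show ?thesis by blast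
qed

lemma support_ge:
  fixes C :: "'a::euclidean_space set"
  assumes "compact C" "v \<in> C"
  shows "u \<bullet> v \<le> max_on C (\<lambda>x. u \<bullet> x)"
proof -
  have "C \<noteq> {}" using assms(2) by auto
  then show ?thesis using support_attained[OF assms(1), of u] assms(2) by auto
qed

text \<open>A maximum of linear functionals is convex, and a finite convex function on a
  finite-dimensional space is continuous.\<close>

lemma continuous_on_support:
  fixes C :: "'a::euclidean_space set"
  assumes "compact C" "C \<noteq> {}"
  shows "continuous_on UNIV (\<lambda>u. max_on C (\<lambda>x. u \<bullet> x))"
proof (rule convex_on_continuous)
  show "convex_on UNIV (\<lambda>u. max_on C (\<lambda>x. u \<bullet> x))"
  proof (intro convex_onI)
    fix t :: real and u w :: 'a assume t: "0 < t" "t < 1"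
    obtain x where x: "x \<in> C"
      "max_on C (\<lambda>x. ((1 - t) *\<^sub>R u + t *\<^sub>R w) \<bullet> x) = ((1 - t) *\<^sub>R u + t *\<^sub>R w) \<bullet> x"
      using support_attained[OF assms] by blast
    have "((1 - t) *\<^sub>R u + t *\<^sub>R w) \<bullet> x = (1 - t) * (u \<bullet> x) + t * (w \<bullet> x)"
      by (simp add: inner_left_distrib)
    also have "\<dots> \<le> (1 - t) * max_on C (\<lambda>x. u \<bullet> x) + t * max_on C (\<lambda>x. w \<bullet> x)"
      using t x(1) support_ge[OF assms(1)] by (intro add_mono mult_left_mono) auto
    finally show "max_on C (\<lambda>x. ((1 - t) *\<^sub>R u + t *\<^sub>R w) \<bullet> x)
        \<le> (1 - t) * max_on C (\<lambda>x. u \<bullet> x) + t * max_on C (\<lambda>x. w \<bullet> x)"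
      using x(2) by simp
  qed auto
qed auto

section \<open>Arbitrary norms against the Euclidean one, and their dual norms\<close>

context
  fixes N :: "'a::euclidean_space \<Rightarrow> real"
  assumes norm_N: "is_norm N"
begin

lemma is_norm_nonneg: "0 \<le> N x" and is_norm_eq_0_iff: "N x = 0 \<longleftrightarrow> x = 0"
  and is_norm_scaleR: "N (a *\<^sub>R x) = \<bar>a\<bar> * N x" and is_norm_triangle: "N (x + y) \<le> N x + N y"
  using norm_N by (auto simp: is_norm_def)

lemma is_norm_pos: "x \<noteq> 0 \<Longrightarrow> 0 < N x"
  using is_norm_nonneg[of x] is_norm_eq_0_iff[of x] by linarith

lemma is_norm_normalize: "x \<noteq> 0 \<Longrightarrow> N ((1 / N x) *\<^sub>R x) = 1"
  using is_norm_pos[of x] by (simp add: is_norm_scaleR)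

lemma is_norm_convex_on: "convex_on UNIV N"
proof (intro convex_onI)
  fix t :: real and x y assume "0 < t" "t < 1"
  then show "N ((1 - t) *\<^sub>R x + t *\<^sub>R y) \<le> (1 - t) * N x + t * N y"
    using is_norm_triangle[of "(1 - t) *\<^sub>R x" "t *\<^sub>R y"] by (simp add: is_norm_scaleR)
qed auto

lemma is_norm_continuous: "continuous_on UNIV N"
  by (rule convex_on_continuous) (auto simp: is_norm_convex_on)

lemma is_norm_convex_ball: "convex {x. N x \<le> 1}"
proof (rule convexI)
  fix x y and a b :: real
  assume xy: "x \<in> {x. N x \<le> 1}" "y \<in> {x. N x \<le> 1}" and ab: "0 \<le> a" "0 \<le> b" "a + b = 1"
  have "N (a *\<^sub>R x + b *\<^sub>R y) \<le> a * N x + b * N y"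
    using is_norm_triangle[of "a *\<^sub>R x" "b *\<^sub>R y"] ab by (simp add: is_norm_scaleR)
  also have "\<dots> \<le> a * 1 + b * 1"
    using xy ab by (intro add_mono mult_left_mono) auto
  finally show "a *\<^sub>R x + b *\<^sub>R y \<in> {x. N x \<le> 1}" using ab by simp
qed

text \<open>One half of the equivalence of norms: the minimum of \<open>N\<close> over the compact
  Euclidean unit sphere is positive and serves as \<open>c\<close>. It makes the balls of
  \<open>N\<close> bounded in the built-in norm.\<close>

lemma is_norm_dominates_norm:
  "\<exists>c>0. \<forall>x. c * norm x \<le> N x"
proof -
  obtain i :: 'a where i: "i \<in> Basis" using SOME_Basis by blast
  then have "i \<in> sphere 0 1" by simp
  then have "sphere (0::'a) 1 \<noteq> {}" by blast
  then obtain z where z: "norm z = 1" "\<And>y. norm y = 1 \<Longrightarrow> N z \<le> N y"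
    using continuous_attains_inf[of "sphere (0::'a) 1" N]
      continuous_on_subset[OF is_norm_continuous, of "sphere 0 1"] by auto
  have "N z * norm x \<le> N x" for x
  proof (cases "x = 0")
    case False
    then have "N z \<le> N ((1 / norm x) *\<^sub>R x)" by (intro z(2)) simp
    then show ?thesis using False by (simp add: is_norm_scaleR field_simps)
  qed (use is_norm_nonneg in auto)
  moreover have "N z > 0" using z(1) by (intro is_norm_pos) auto
  ultimately show ?thesis by blast
qed

lemma is_norm_bounded: "bounded {x. N x \<le> r}"
proof -
  obtain c where c: "c > 0" "\<And>x. c * norm x \<le> N x"
    using is_norm_dominates_norm by blast
  have "norm x \<le> r / c" if "N x \<le> r" for x
    using c(2)[of x] that c(1) by (simp add: field_simps)
  then show ?thesis by (intro boundedI[of _ "r / c"]) auto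
qed

lemma is_norm_compact_sphere: "compact {x. N x = 1}"
proof -
  have "closed {x. N x = 1}"
    by (intro closed_Collect_eq is_norm_continuous continuous_on_const)
  moreover have "bounded {x. N x = 1}"
    by (rule bounded_subset[OF is_norm_bounded[of 1]]) auto
  ultimately show ?thesis by (simp add: compact_eq_bounded_closed)
qed

lemma is_norm_compact_ball: "compact {x. N x \<le> 1}"
proof -
  have "closed {x. N x \<le> 1}"
    by (intro closed_Collect_le is_norm_continuous continuous_on_const)
  then show ?thesis using is_norm_bounded by (simp add: compact_eq_bounded_closed)
qed

lemma is_norm_sphere_nonempty: "{x. N x = 1} \<noteq> {}"
proof -
  obtain i :: 'a where "i \<in> Basis" using SOME_Basis by blast
  then have "N ((1 / N i) *\<^sub>R i) = 1" by (intro is_norm_normalize) auto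
  then show ?thesis by blast
qed

lemma dual_norm_attained:
  obtains x where "N x = 1" "dual_norm N u = u \<bullet> x"
  using support_attained[OF is_norm_compact_sphere is_norm_sphere_nonempty, of u]
  unfolding dual_norm_def by blast

lemma inner_le_dual_norm: "u \<bullet> x \<le> dual_norm N u * N x"
proof (cases "x = 0")
  case False
  then have "u \<bullet> ((1 / N x) *\<^sub>R x) \<le> dual_norm N u"
    unfolding dual_norm_def
    by (intro support_ge) (auto simp: is_norm_normalize is_norm_compact_sphere)
  then show ?thesis using is_norm_pos[OF False] by (simp add: field_simps)
qed (simp add: is_norm_eq_0_iff[THEN iffD2])

text \<open>Allows the facts on \<open>N\<close> (continuity, compact spheres, bounded balls) to be
  applied to its dual norm as well.\<close>

lemma is_norm_dual_norm: "is_norm (dual_norm N)"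
proof -
  have sup: "u \<bullet> x \<le> dual_norm N u" if "N x = 1" for u x
    using inner_le_dual_norm[of u x] that by simp
  have minus: "N (- x) = N x" for x using is_norm_scaleR[of "-1" x] by simp
  have pos: "dual_norm N u > 0" if "u \<noteq> 0" for u
  proof -
    have "0 < u \<bullet> u" using that by simp
    also have "\<dots> \<le> dual_norm N u * N u" by (rule inner_le_dual_norm)
    finally show ?thesis using is_norm_pos[OF that] by (simp add: zero_less_mult_iff)
  qed
  have zero: "dual_norm N 0 = 0"
    by (rule dual_norm_attained[of 0]) simp
  have scale: "dual_norm N (a *\<^sub>R u) = \<bar>a\<bar> * dual_norm N u" for a u
  proof -
    obtain x where x: "N x = 1" "dual_norm N u = u \<bullet> x" by (rule dual_norm_attained)
    obtain y where y: "N y = 1" "dual_norm N (a *\<^sub>R u) = a *\<^sub>R u \<bullet> y" by (rule dual_norm_attained)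
    show ?thesis
    proof (cases "a \<ge> 0")
      case True
      have "a * (u \<bullet> y) \<le> a * (u \<bullet> x)"
        using True sup[OF y(1), of u] x by (intro mult_left_mono) auto
      moreover have "a * (u \<bullet> x) \<le> a * (u \<bullet> y)"
        using sup[OF x(1), of "a *\<^sub>R u"] y by simp
      ultimately show ?thesis using True x y by simp
    next
      case False
      \<comment> \<open>The unit sphere of \<open>N\<close> is symmetric, so for negative
        \<open>a\<close> the maximisers are compared after a sign change.\<close>
      have "- a * (u \<bullet> (- y)) \<le> - a * (u \<bullet> x)"
        using False sup[of "- y" u] x y minus by (intro mult_left_mono) auto
      moreover have "- a * (u \<bullet> x) \<le> a * (u \<bullet> y)"
        using sup[of "- x" "a *\<^sub>R u"] x y minus by simp
      ultimately show ?thesis using False x y by simp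
    qed
  qed
  have tri: "dual_norm N (u + w) \<le> dual_norm N u + dual_norm N w" for u w
  proof -
    obtain x where "N x = 1" "dual_norm N (u + w) = (u + w) \<bullet> x" by (rule dual_norm_attained)
    then show ?thesis using sup[of x u] sup[of x w] by (simp add: inner_left_distrib)
  qed
  have "0 \<le> dual_norm N u" for u using pos[of u] zero by (cases "u = 0") auto
  moreover have "dual_norm N u = 0 \<longleftrightarrow> u = 0" for u using pos[of u] zero by (cases "u = 0") auto
  ultimately show ?thesis unfolding is_norm_def using scale tri by blast
qed

end

lemma is_norm_norm: "is_norm (norm :: 'a::euclidean_space \<Rightarrow> real)"
  by (auto simp: is_norm_def norm_triangle_ineq)

text \<open>Cauchy-Schwarz bounds the maximum from above; testing \<open>u\<close> against itself
  bounds it from below.\<close>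

lemma dual_norm_norm: "dual_norm norm u = norm (u :: 'a::euclidean_space)"
proof (cases "u = 0")
  case True
  then show ?thesis
    using is_norm_eq_0_iff[OF is_norm_dual_norm[OF is_norm_norm], of u] by simp
next
  case False
  obtain x where x: "norm x = 1" "dual_norm norm u = u \<bullet> x"
    using dual_norm_attained[OF is_norm_norm] .
  have "u \<bullet> u \<le> dual_norm norm u * norm u" by (rule inner_le_dual_norm[OF is_norm_norm])
  then have "norm u \<le> dual_norm norm u"
    using False by (simp add: dot_square_norm power2_eq_square)
  then show ?thesis using x norm_cauchy_schwarz[of u x] by simp
qed

subsection \<open>Regular cones and their duals\<close>

lemma mem_orthogonal_comp_iff: "x \<in> L\<^sup>\<bottom> \<longleftrightarrow> (\<forall>y\<in>L. x \<bullet> y = 0)"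
  by (auto simp: orthogonal_comp_def orthogonal_def inner_commute)

lemma closed_dual_cone: "closed (dual_cone (K :: 'a::euclidean_space set))"
proof -
  have "dual_cone K = (\<Inter>x\<in>K. {u. 0 \<le> u \<bullet> x})" by (auto simp: dual_cone_def)
  then show ?thesis
    by (auto intro!: closed_INT closed_Collect_le continuous_on_const continuous_on_inner continuous_on_id)
qed

lemma dual_cone_scaleR: "u \<in> dual_cone K \<Longrightarrow> 0 \<le> c \<Longrightarrow> c *\<^sub>R u \<in> dual_cone K"
  by (auto simp: dual_cone_def)

lemma inner_dual_cone_nonneg: "u \<in> dual_cone K \<Longrightarrow> x \<in> K \<Longrightarrow> 0 \<le> u \<bullet> x"
  by (auto simp: dual_cone_def)

context
  fixes K :: "'a::euclidean_space set"
  assumes reg: "regular_cone K"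
begin

lemma regular_cone_closed: "closed K"
  and regular_cone_zero: "0 \<in> K"
  and regular_cone_add: "x \<in> K \<Longrightarrow> y \<in> K \<Longrightarrow> x + y \<in> K"
  and regular_cone_scaleR: "0 \<le> c \<Longrightarrow> x \<in> K \<Longrightarrow> c *\<^sub>R x \<in> K"
  using reg by (auto simp: regular_cone_def convex_cone_iff)

lemma regular_cone_convex: "convex K"
  using reg by (auto simp: regular_cone_def convex_cone_def)

lemma regular_cone_pointed:
  assumes "x \<in> K" "- x \<in> K"
  shows "x = 0"
proof (rule ccontr)
  assume "x \<noteq> 0"
  moreover have "0 + t *\<^sub>R x \<in> K" for t
    using regular_cone_scaleR[of t x] regular_cone_scaleR[of "- t" "- x"] assms by (cases "0 \<le> t") auto
  ultimately show False using reg unfolding regular_cone_def by blast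
qed

lemma interior_regular_cone_nonzero:
  assumes "x \<in> interior K"
  shows "x \<noteq> 0"
proof
  assume "x = 0"
  then obtain r where r: "r > 0" "cball 0 r \<subseteq> K" using assms mem_interior_cball by blast
  obtain i :: 'a where i: "i \<in> Basis" using SOME_Basis by blast
  have "r *\<^sub>R i \<in> K" "- (r *\<^sub>R i) \<in> K" using r i by auto
  then have "r *\<^sub>R i = 0" by (rule regular_cone_pointed)
  then show False using r i by auto
qed

text \<open>If the ball of radius \<open>d\<close> around \<open>x\<close> lies in \<open>K\<close>,
  then so does the point reached from \<open>x\<close> by going the distance \<open>d\<close>
  against \<open>u\<close>, and there \<open>u\<close> is nonnegative. The uniform \<open>d\<close>
  later bounds dual variables through their value at one point.\<close>

lemma inner_interior_dual_cone_ge: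
  assumes "x \<in> interior K"
  shows "\<exists>d>0. \<forall>u\<in>dual_cone K. d * norm u \<le> u \<bullet> x"
proof -
  obtain r where r: "r > 0" "cball x r \<subseteq> K" using assms mem_interior_cball by blast
  have "r * norm u \<le> u \<bullet> x" if u: "u \<in> dual_cone K" for u
  proof (cases "u = 0")
    case False
    have "x - (r / norm u) *\<^sub>R u \<in> cball x r" using False r(1) by (simp add: dist_norm)
    then have "0 \<le> u \<bullet> (x - (r / norm u) *\<^sub>R u)"
      using r(2) u by (intro inner_dual_cone_nonneg[of u K]) auto
    then show ?thesis
      using False by (simp add: inner_diff_right dot_square_norm power2_eq_square)
  qed simp
  then show ?thesis using r(1) by blast
qed

lemma inner_interior_dual_cone_pos:
  assumes "x \<in> interior K" "u \<in> dual_cone K" "u \<noteq> 0"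
  shows "0 < u \<bullet> x"
proof -
  obtain d where "d > 0" "d * norm u \<le> u \<bullet> x" using inner_interior_dual_cone_ge assms by blast
  moreover from this assms have "0 < d * norm u" by simp
  ultimately show ?thesis by linarith
qed

text \<open>Pointedness keeps \<open>- v\<close> outside \<open>K\<close>; a hyperplane separating
  it from \<open>K\<close> has a normal in the dual cone that is positive at \<open>v\<close>, and
  rescaling normalises it.\<close>

lemma dual_cone_normalized_exists:
  assumes "v \<in> K" "v \<noteq> 0"
  shows "\<exists>u\<in>dual_cone K. u \<bullet> v = 1"
proof -
  have "- v \<notin> K" using regular_cone_pointed assms by blast
  then obtain a b where ab: "a \<bullet> (- v) < b" "\<And>x. x \<in> K \<Longrightarrow> b < a \<bullet> x"
    using separating_hyperplane_closed_point[OF regular_cone_convex regular_cone_closed, of "- v"] by blast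
  have b: "b < 0" using ab(2)[OF regular_cone_zero] by simp
  have "0 \<le> a \<bullet> x" if "x \<in> K" for x
  proof (rule ccontr)
    assume neg: "\<not> 0 \<le> a \<bullet> x"
    \<comment> \<open>This multiple of \<open>x\<close> has inner product exactly \<open>b\<close>
      with \<open>a\<close>, against the strict separation.\<close>
    then have "(b / (a \<bullet> x)) *\<^sub>R x \<in> K" using that b by (intro regular_cone_scaleR) (auto simp: divide_nonpos_neg)
    from ab(2)[OF this] neg show False by simp
  qed
  then have a: "a \<in> dual_cone K" by (simp add: dual_cone_def)
  have "0 < a \<bullet> v" using ab(1) b by simp
  then show ?thesis using dual_cone_scaleR[OF a, of "1 / (a \<bullet> v)"] by (intro bexI) auto
qed

end

text \<open>Turns a bound valid along a whole ray into a sign condition; the separation argument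
  below uses it for \<open>K\<close> and for \<open>L\<close>.\<close>

lemma nonpos_if_multiples_bounded:
  fixes a b :: real
  assumes "\<And>s. 0 \<le> s \<Longrightarrow> s * a \<le> b"
  shows "a \<le> 0"
proof (rule ccontr)
  assume "\<not> a \<le> 0"
  then show False using assms[of "(\<bar>b\<bar> + 1) / a"] by (simp add: divide_nonneg_pos)
qed

subsection \<open>Duality for the inner maximum of the sigma measure\<close>

text \<open>The common point \<open>p\<close> of \<open>L\<close> and the interior of
  \<open>K\<close> is a parameter, because boundedness and nondegeneracy of dual vectors are read
  off from their values at it.\<close>

locale subspace_meeting_cone =
  fixes K L :: "'a::euclidean_space set" and N :: "'a \<Rightarrow> real" and p :: 'a
  assumes reg: "regular_cone K" and sub: "subspace L"
    and pL: "p \<in> L" and pK: "p \<in> interior K" and norm_N: "is_norm N"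
begin

lemmas norm_D = is_norm_dual_norm[OF norm_N]

text \<open>The constraints of the joint dual problem, with \<open>w\<close> standing for
  \<open>u - y\<close>, \<open>y\<close> in \<open>L\<^sup>\<bottom>\<close>, so that the objective
  is just \<open>dual_norm N w\<close>. Including \<open>v\<close> turns the minimum over
  \<open>v\<close> of the dual minima into a single minimum.\<close>

definition feasible :: "('a \<times> 'a \<times> 'a) set" where
  "feasible = {(v, u, w). v \<in> K \<and> N v = 1 \<and> u \<in> dual_cone K \<and> u \<bullet> v = 1 \<and> u - w \<in> L\<^sup>\<bottom>}"

text \<open>Nonnegativity of \<open>u\<close> on \<open>K\<close> gives
  \<open>t \<le> u \<bullet> x\<close>; on \<open>L\<close> the vectors \<open>u\<close> and
  \<open>w\<close> agree, and \<open>w \<bullet> x\<close> is at most the dual norm of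
  \<open>w\<close>.\<close>

lemma weak_duality:
  assumes "x \<in> L" "N x \<le> 1" "x - t *\<^sub>R v \<in> K" "u \<in> dual_cone K" "u \<bullet> v = 1" "u - w \<in> L\<^sup>\<bottom>"
  shows "t \<le> dual_norm N w"
proof -
  have "0 \<le> u \<bullet> (x - t *\<^sub>R v)" using assms(3,4) by (rule inner_dual_cone_nonneg[rotated])
  then have "t \<le> u \<bullet> x" using assms(5) by (simp add: inner_diff_right)
  also have "u \<bullet> x = w \<bullet> x"
    using assms(1,6) by (simp add: mem_orthogonal_comp_iff inner_diff_left)
  also have "\<dots> \<le> dual_norm N w * N x" by (rule inner_le_dual_norm[OF norm_N])
  also have "\<dots> \<le> dual_norm N w"
    using assms(2) is_norm_nonneg[OF norm_D] by (simp add: mult_left_le)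
  finally show ?thesis .
qed

text \<open>A normalised dual vector bounds all admissible \<open>t\<close> and \<open>K\<close> is
  closed, so the supremum is attained and the \<open>GREATEST\<close> in \<open>cone_lambda\<close>
  denotes it.\<close>

lemma cone_lambda_attained:
  assumes "v \<in> K" "v \<noteq> 0" "x - t *\<^sub>R v \<in> K"
  shows "\<exists>T\<ge>t. cone_lambda K v x = ereal T \<and> x - T *\<^sub>R v \<in> K"
proof -
  let ?S = "{t. x - t *\<^sub>R v \<in> K}"
  obtain u where u: "u \<in> dual_cone K" "u \<bullet> v = 1"
    using dual_cone_normalized_exists[OF reg assms(1,2)] by blast
  have "s \<le> u \<bullet> x" if "s \<in> ?S" for s
    using inner_dual_cone_nonneg[OF u(1), of "x - s *\<^sub>R v"] that u(2) by (simp add: inner_diff_right)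
  then have bdd: "bdd_above ?S" by (rule bdd_aboveI)
  have "closed ((\<lambda>t. x - t *\<^sub>R v) -` K)"
    by (intro closed_vimage regular_cone_closed[OF reg] continuous_intros)
  then have cl: "closed ?S" by (simp add: vimage_def)
  have ne: "?S \<noteq> {}" using assms(3) by blast
  have in_S: "Sup ?S \<in> ?S" using closed_contains_Sup[OF ne bdd cl] .
  have upper: "s \<le> Sup ?S" if "s \<in> ?S" for s using cSup_upper[OF that bdd] .
  have "(GREATEST t. x - t *\<^sub>R v \<in> K) = Sup ?S"
    using in_S upper by (intro Greatest_equality) auto
  then have "cone_lambda K v x = ereal (Sup ?S)"
    using assms(3) unfolding cone_lambda_def by auto
  then show ?thesis using in_S upper[of t] assms(3) by blast
qed

text \<open>The maxima over \<open>x\<close> and over \<open>t\<close> are merged into one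
  maximisation of \<open>t\<close> over pairs \<open>(x, t)\<close>. Weak duality bounds
  \<open>t\<close> above, and the admissible pair \<open>(0, 0)\<close> allows restricting to
  \<open>t \<ge> 0\<close>, which makes the set of pairs compact.\<close>

lemma inner_max_attained:
  assumes v: "v \<in> K" "N v = 1"
  shows "\<exists>t x. max_on {x \<in> L. N x \<le> 1} (cone_lambda K v) = ereal t \<and>
    x \<in> L \<and> N x \<le> 1 \<and> x - t *\<^sub>R v \<in> K \<and> 0 \<le> t \<and>
    (\<forall>y s. y \<in> L \<longrightarrow> N y \<le> 1 \<longrightarrow> y - s *\<^sub>R v \<in> K \<longrightarrow> s \<le> t)"
proof -
  have v0: "v \<noteq> 0" using v is_norm_eq_0_iff[OF norm_N, of v] by auto
  obtain u where u: "u \<in> dual_cone K" "u \<bullet> v = 1"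
    using dual_cone_normalized_exists[OF reg v(1) v0] by blast
  let ?M = "dual_norm N u"
  let ?B = "(L \<inter> {x. N x \<le> 1}) \<times> {0..?M}"
  let ?Q = "?B \<inter> (\<lambda>(x, t). x - t *\<^sub>R v) -` K"
  \<comment> \<open>Weak duality with \<open>w = u\<close>, that is, with the zero vector of
    \<open>L\<^sup>\<bottom>\<close>.\<close>
  have M: "s \<le> ?M" if "y \<in> L" "N y \<le> 1" "y - s *\<^sub>R v \<in> K" for y s
    using weak_duality[OF that u, of u] by (simp add: mem_orthogonal_comp_iff)
  have "compact ?B"
    using is_norm_compact_ball[OF norm_N] closed_subspace[OF sub]
    by (intro compact_Times closed_Int_compact) auto
  moreover have "closed ((\<lambda>(x, t). x - t *\<^sub>R v) -` K)"
    unfolding case_prod_unfold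
    by (intro closed_vimage regular_cone_closed[OF reg] continuous_intros)
  ultimately have "compact ?Q" by (rule compact_Int_closed)
  moreover have "(0, 0) \<in> ?Q"
    using subspace_0[OF sub] is_norm_eq_0_iff[OF norm_N, of 0] is_norm_nonneg[OF norm_D]
      regular_cone_zero[OF reg] by auto
  then have "?Q \<noteq> {}" by blast
  moreover have "continuous_on ?Q snd" by (intro continuous_intros)
  ultimately have "\<exists>q\<in>?Q. \<forall>q'\<in>?Q. snd q' \<le> snd q" by (rule continuous_attains_sup)
  then obtain q where q: "q \<in> ?Q" "\<forall>q'\<in>?Q. snd q' \<le> snd q" ..
  obtain x t where xt: "q = (x, t)" by (cases q)
  have x: "x \<in> L" "N x \<le> 1" "x - t *\<^sub>R v \<in> K" "0 \<le> t" using q(1) xt by auto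
  have max: "s \<le> t" if "y \<in> L" "N y \<le> 1" "y - s *\<^sub>R v \<in> K" for y s
  proof (cases "0 \<le> s")
    case True
    then have "(y, s) \<in> ?Q" using that M[OF that] by auto
    from q(2)[rule_format, OF this] xt show ?thesis by simp
  next
    case False
    then show ?thesis using x(4) by linarith
  qed
  have le: "cone_lambda K v y \<le> ereal t" if y: "y \<in> {x \<in> L. N x \<le> 1}" for y
  proof (cases "\<exists>s. y - s *\<^sub>R v \<in> K")
    case True
    then obtain s where "y - s *\<^sub>R v \<in> K" ..
    from cone_lambda_attained[OF v(1) v0 this] obtain T
      where "cone_lambda K v y = ereal T" "y - T *\<^sub>R v \<in> K" by blast
    then show ?thesis using max[of y T] y by simp
  qed (simp add: cone_lambda_def)
  obtain T where T: "T \<ge> t" "cone_lambda K v x = ereal T"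
    using cone_lambda_attained[OF v(1) v0 x(3)] by blast
  then have eq: "cone_lambda K v x = ereal t" using le[of x] x by simp
  have "max_on {x \<in> L. N x \<le> 1} (cone_lambda K v) = cone_lambda K v x"
    using x le eq by (intro max_on_eqI) auto
  then show ?thesis using eq x max by auto
qed

text \<open>
  A hyperplane in the product space separates the points \<open>(b - x, x - k)\<close>, where \<open>N b \<le> 1\<close>,
  \<open>x \<in> L\<close> and \<open>k \<in> K\<close>, from the open ray of all \<open>(0, s *\<^sub>R v)\<close> with \<open>s > t\<close>. Its normal vector
  \<open>(w, u)\<close> is the dual solution, so that no separate Hahn-Banach argument for \<open>L\<close> is needed.
\<close>

lemma strong_duality:
  assumes v: "v \<in> K" "N v = 1"
    and max: "\<And>y s. y \<in> L \<Longrightarrow> N y \<le> 1 \<Longrightarrow> y - s *\<^sub>R v \<in> K \<Longrightarrow> s \<le> t"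
  shows "\<exists>u w. (v, u, w) \<in> feasible \<and> dual_norm N w \<le> t"
proof -
  let ?f = "\<lambda>(b, x, k). (b - x, x - k) :: 'a \<times> 'a"
  let ?S = "?f ` ({b. N b \<le> 1} \<times> L \<times> K)"
  let ?T = "(\<lambda>s. (0, s *\<^sub>R v) :: 'a \<times> 'a) ` {t<..}"
  have N0: "N 0 = 0" using is_norm_eq_0_iff[OF norm_N, of 0] by simp
  have "linear ?f" by (intro linearI) (auto simp: algebra_simps)
  then have "convex ?S"
    by (intro convex_linear_image convex_Times is_norm_convex_ball[OF norm_N]
        subspace_imp_convex[OF sub] regular_cone_convex[OF reg])
  moreover have "linear (\<lambda>s. (0, s *\<^sub>R v) :: 'a \<times> 'a)"
    by (intro linearI) (auto simp: algebra_simps)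
  then have "convex ?T" by (intro convex_linear_image) auto
  moreover have "(0, 0, 0) \<in> {b. N b \<le> 1} \<times> L \<times> K"
    using N0 subspace_0[OF sub] regular_cone_zero[OF reg] by auto
  then have "?S \<noteq> {}" by blast
  moreover have "?T \<noteq> {}" by auto
  moreover have "?S \<inter> ?T = {}"
  proof (rule ccontr)
    assume "?S \<inter> ?T \<noteq> {}"
    then obtain z where z: "z \<in> ?S" "z \<in> ?T" by blast
    obtain b x k where *: "N b \<le> 1" "x \<in> L" "k \<in> K" "z = (b - x, x - k)" using z(1) by auto
    obtain s where s: "s > t" "z = (0, s *\<^sub>R v)" using z(2) by auto
    have "b = x" "x - k = s *\<^sub>R v" using *(4) s(2) by auto
    then have "x - s *\<^sub>R v = k" "N x \<le> 1" using *(1) by (auto simp: algebra_simps)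
    then show False using max[of x s] * s(1) by auto
  qed
  ultimately have "\<exists>a \<beta>. a \<noteq> 0 \<and> (\<forall>z\<in>?S. a \<bullet> z \<le> \<beta>) \<and> (\<forall>z\<in>?T. a \<bullet> z \<ge> \<beta>)"
    by (rule separating_hyperplane_sets)
  then obtain a \<beta> where a: "a \<noteq> 0" "\<forall>z\<in>?S. a \<bullet> z \<le> \<beta>" "\<forall>z\<in>?T. a \<bullet> z \<ge> \<beta>"
    by (elim exE conjE)
  obtain w u where wu: "a = (w, u)" by (cases a)
  have S: "w \<bullet> (b - x) + u \<bullet> (x - k) \<le> \<beta>" if "N b \<le> 1" "x \<in> L" "k \<in> K" for b x k
  proof -
    have "?f (b, x, k) \<in> ?S" using that by (intro imageI) auto
    from bspec[OF a(2) this] wu show ?thesis by simp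
  qed
  define c where "c = u \<bullet> v"
  have T: "\<beta> \<le> s * c" if "s > t" for s
  proof -
    have "(0, s *\<^sub>R v) \<in> ?T" using that by (intro imageI) auto
    from bspec[OF a(3) this] wu show ?thesis by (simp add: c_def)
  qed
  have \<beta>: "\<beta> \<le> t * c"
  proof (rule ccontr)
    assume less: "\<not> \<beta> \<le> t * c"
    \<comment> \<open>The step from \<open>t\<close> to \<open>t + d\<close> raises
      \<open>s * c\<close> by at most half the assumed gap; the added 1 keeps the denominator
      positive.\<close>
    define d where "d = (\<beta> - t * c) / (2 * (\<bar>c\<bar> + 1))"
    have d: "d > 0" using less by (simp add: d_def)
    have "\<beta> \<le> (t + d) * c" using d by (intro T) simp
    also have "\<dots> \<le> t * c + d * (\<bar>c\<bar> + 1)"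
      using d mult_left_mono[of c "\<bar>c\<bar> + 1" d] by (simp add: algebra_simps)
    also have "d * (\<bar>c\<bar> + 1) = (\<beta> - t * c) / 2"
    proof -
      have "\<bar>c\<bar> + 1 \<noteq> 0" by simp
      then show ?thesis unfolding d_def by (simp add: field_simps)
    qed
    finally have "\<beta> - t * c \<le> (\<beta> - t * c) / 2" by (simp only: diff_le_eq add.commute)
    then show False using less by (simp add: field_simps)
  qed
  \<comment> \<open>The first set extends along all multiples of vectors of \<open>K\<close> and
    \<open>L\<close>, so the bound \<open>\<beta>\<close> forces a sign on \<open>K\<close> and,
    \<open>L\<close> being symmetric, orthogonality of \<open>u - w\<close> to
    \<open>L\<close>.\<close>
  have "0 \<le> u \<bullet> k" if "k \<in> K" for k
  proof -
    have "s * (- (u \<bullet> k)) \<le> \<beta>" if "0 \<le> s" for s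
      using S[of 0 0 "s *\<^sub>R k"] N0 subspace_0[OF sub] regular_cone_scaleR[OF reg that \<open>k \<in> K\<close>] by simp
    then show ?thesis using nonpos_if_multiples_bounded[of "- (u \<bullet> k)" \<beta>] by simp
  qed
  then have u: "u \<in> dual_cone K" by (simp add: dual_cone_def)
  have L_le: "(u - w) \<bullet> x \<le> 0" if "x \<in> L" for x
  proof (rule nonpos_if_multiples_bounded)
    fix s :: real
    show "s * ((u - w) \<bullet> x) \<le> \<beta>"
      using S[of 0 "s *\<^sub>R x" 0] N0 regular_cone_zero[OF reg] subspace_scale[OF sub that]
      by (simp add: algebra_simps)
  qed
  have L_eq: "(u - w) \<bullet> x = 0" if "x \<in> L" for x
    using L_le[OF that] L_le[OF subspace_neg[OF sub that]] by simp
  have w: "w \<bullet> b \<le> \<beta>" if "N b \<le> 1" for b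
    using S[OF that subspace_0[OF sub] regular_cone_zero[OF reg]] by simp
  \<comment> \<open>Slater's condition at work: \<open>c = 0\<close> would force
    \<open>w = 0\<close>, so that \<open>u\<close> vanishes at \<open>p\<close> in \<open>L\<close>.
    An interior point allows this only for \<open>u = 0\<close>, but the normal
    \<open>(w, u)\<close> is nonzero.\<close>
  have "c \<noteq> 0"
  proof
    assume "c = 0"
    obtain b where b: "N b = 1" "dual_norm N w = w \<bullet> b" by (rule dual_norm_attained[OF norm_N])
    have "dual_norm N w \<le> 0" using w[of b] b \<beta> \<open>c = 0\<close> by simp
    then have "w = 0" using is_norm_pos[OF norm_D, of w] by linarith
    then have "u \<noteq> 0" using a(1) wu by (auto simp: zero_prod_def)
    then have "0 < u \<bullet> p" using inner_interior_dual_cone_pos[OF reg pK u] by simp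
    then show False using L_eq[OF pL] \<open>w = 0\<close> by simp
  qed
  moreover have "0 \<le> c" unfolding c_def using u v(1) by (rule inner_dual_cone_nonneg)
  ultimately have c: "c > 0" by simp
  \<comment> \<open>Dividing by \<open>c\<close> normalises \<open>u \<bullet> v\<close> to 1 and
    turns the bound \<open>t * c\<close> on the dual norm of \<open>w\<close> into
    \<open>t\<close>.\<close>
  have "(v, (1 / c) *\<^sub>R u, (1 / c) *\<^sub>R w) \<in> feasible"
    using v dual_cone_scaleR[OF u, of "1 / c"] c c_def L_eq
    by (auto simp: feasible_def mem_orthogonal_comp_iff inner_diff_left)
  moreover have "dual_norm N ((1 / c) *\<^sub>R w) \<le> t"
  proof -
    obtain b where b: "N b = 1" "dual_norm N w = w \<bullet> b" by (rule dual_norm_attained[OF norm_N])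
    then have "dual_norm N w \<le> t * c" using w[of b] \<beta> by simp
    then show ?thesis using c by (simp add: is_norm_scaleR[OF norm_D] field_simps)
  qed
  ultimately show ?thesis by blast
qed

section \<open>Compactness, and attainment of the sigma and nu measures\<close>

lemma feasible_exists:
  assumes "v \<in> K" "N v = 1"
  shows "\<exists>u. (v, u, u) \<in> feasible"
proof -
  have "v \<noteq> 0" using assms is_norm_eq_0_iff[OF norm_N, of v] by auto
  then obtain u where "u \<in> dual_cone K" "u \<bullet> v = 1"
    using dual_cone_normalized_exists[OF reg assms(1)] by blast
  then have "(v, u, u) \<in> feasible" using assms by (simp add: feasible_def mem_orthogonal_comp_iff)
  then show ?thesis ..
qed

lemma cone_sphere_nonempty: "{v \<in> K. N v = 1} \<noteq> {}"
proof -
  have p: "p \<in> K" "p \<noteq> 0"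
    using pK interior_subset interior_regular_cone_nonzero[OF reg] by auto
  then have "(1 / N p) *\<^sub>R p \<in> K"
    using is_norm_nonneg[OF norm_N] by (intro regular_cone_scaleR[OF reg]) auto
  then show ?thesis using is_norm_normalize[OF norm_N p(2)] by blast
qed

lemma cone_sphere_compact: "compact {v \<in> K. N v = 1}"
proof -
  have "{v \<in> K. N v = 1} = K \<inter> {v. N v = 1}" by auto
  then show ?thesis
    using regular_cone_closed[OF reg] is_norm_compact_sphere[OF norm_N]
    by (simp add: closed_Int_compact)
qed

lemma dual_sphere_compact: "compact {u \<in> dual_cone K. dual_norm N u = 1}"
proof -
  have "{u \<in> dual_cone K. dual_norm N u = 1} = dual_cone K \<inter> {u. dual_norm N u = 1}" by auto
  then show ?thesis
    using closed_dual_cone[of K] is_norm_compact_sphere[OF norm_D]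
    by (simp add: closed_Int_compact)
qed

lemma dual_sphere_nonempty: "{u \<in> dual_cone K. dual_norm N u = 1} \<noteq> {}"
proof -
  obtain v where v: "v \<in> K" "N v = 1" using cone_sphere_nonempty by blast
  then obtain u where u: "u \<in> dual_cone K" "u \<bullet> v = 1"
    using feasible_exists[OF v] unfolding feasible_def by blast
  then have "u \<noteq> 0" by auto
  then have "dual_norm N ((1 / dual_norm N u) *\<^sub>R u) = 1" by (rule is_norm_normalize[OF norm_D])
  moreover have "(1 / dual_norm N u) *\<^sub>R u \<in> dual_cone K"
    using u(1) is_norm_nonneg[OF norm_D] by (intro dual_cone_scaleR) auto
  ultimately show ?thesis by blast
qed

lemma feasible_closed: "closed feasible"
proof -
  let ?v = "fst :: 'a \<times> 'a \<times> 'a \<Rightarrow> 'a" and ?u = "\<lambda>z :: 'a \<times> 'a \<times> 'a. fst (snd z)"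
    and ?w = "\<lambda>z :: 'a \<times> 'a \<times> 'a. snd (snd z)"
  have "feasible = ?v -` {v \<in> K. N v = 1} \<inter> ?u -` dual_cone K \<inter> {z. ?u z \<bullet> ?v z = 1}
    \<inter> (\<lambda>z. ?u z - ?w z) -` (L\<^sup>\<bottom>)"
    by (auto simp: feasible_def)
  moreover have "closed \<dots>"
    by (intro closed_Int closed_vimage closed_Collect_eq compact_imp_closed[OF cone_sphere_compact]
        closed_dual_cone closed_subspace[OF subspace_orthogonal_comp] continuous_intros)
  ultimately show ?thesis by simp
qed

text \<open>Here \<open>v\<close> ranges over a compact set and \<open>w\<close> over a dual ball.
  The value of \<open>u\<close> at \<open>p\<close> equals that of \<open>w\<close>, since
  \<open>p\<close> is in \<open>L\<close>, and it controls the Euclidean norm of \<open>u\<close>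
  because \<open>p\<close> is interior.\<close>

lemma feasible_sublevel_bounded: "bounded {z \<in> feasible. dual_norm N (snd (snd z)) \<le> c}"
proof -
  obtain d where d: "d > 0" "\<And>u. u \<in> dual_cone K \<Longrightarrow> d * norm u \<le> u \<bullet> p"
    using inner_interior_dual_cone_ge[OF reg pK] by blast
  have "{z \<in> feasible. dual_norm N (snd (snd z)) \<le> c}
      \<subseteq> {v \<in> K. N v = 1} \<times> cball 0 (c * N p / d) \<times> {w. dual_norm N w \<le> c}"
  proof safe
    fix v u w assume z: "(v, u, w) \<in> feasible" "dual_norm N (snd (snd (v, u, w))) \<le> c"
    then show "v \<in> K" "N v = 1" "dual_norm N w \<le> c" by (auto simp: feasible_def)
    have "d * norm u \<le> u \<bullet> p" using z(1) by (intro d(2)) (auto simp: feasible_def)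
    also have "u \<bullet> p = w \<bullet> p"
      using z(1) pL by (auto simp: feasible_def mem_orthogonal_comp_iff inner_diff_left)
    also have "\<dots> \<le> dual_norm N w * N p" by (rule inner_le_dual_norm[OF norm_N])
    also have "\<dots> \<le> c * N p"
      using z(2) is_norm_nonneg[OF norm_N] by (intro mult_right_mono) auto
    finally show "u \<in> cball 0 (c * N p / d)" using d(1) by (simp add: field_simps)
  qed
  moreover have "bounded ({v \<in> K. N v = 1} \<times> cball 0 (c * N p / d) \<times> {w. dual_norm N w \<le> c})"
    by (intro bounded_Times compact_imp_bounded[OF cone_sphere_compact] bounded_cball
        is_norm_bounded[OF norm_D])
  ultimately show ?thesis by (rule bounded_subset[rotated])
qed

text \<open>Strong duality bounds the inner maximum at every \<open>v\<close> below by the minimum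
  over \<open>feasible\<close>; weak duality gives equality at the \<open>v\<close> of a
  minimiser.\<close>

lemma sigma_measure_attained:
  "\<exists>v u w. (v, u, w) \<in> feasible \<and> sigma_measure N K L = ereal (dual_norm N w) \<and>
    (\<forall>v' u' w'. (v', u', w') \<in> feasible \<longrightarrow> dual_norm N w \<le> dual_norm N w')"
proof -
  let ?g = "\<lambda>z :: 'a \<times> 'a \<times> 'a. dual_norm N (snd (snd z))"
  have "feasible \<noteq> {}" using cone_sphere_nonempty feasible_exists by blast
  moreover have "continuous_on UNIV ?g"
    by (intro continuous_on_compose2[OF is_norm_continuous[OF norm_D]] continuous_intros) auto
  ultimately have "\<exists>z\<in>feasible. min_on feasible ?g = ?g z \<and> (\<forall>z'\<in>feasible. ?g z \<le> ?g z')"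
    by (intro min_on_attained feasible_closed feasible_sublevel_bounded)
  then obtain z where z: "z \<in> feasible" and zmin: "\<And>z'. z' \<in> feasible \<Longrightarrow> ?g z \<le> ?g z'" by blast
  obtain v u w where vuw: "z = (v, u, w)" by (cases z)
  note z = z[unfolded vuw]
  have min: "dual_norm N w \<le> dual_norm N w'" if "(v', u', w') \<in> feasible" for v' u' w'
    using zmin[OF that] vuw by simp
  let ?G = "\<lambda>v. max_on {x \<in> L. N x \<le> 1} (cone_lambda K v)"
  have v: "v \<in> K" "N v = 1" using z by (auto simp: feasible_def)
  have ge: "ereal (dual_norm N w) \<le> ?G v'" if "v' \<in> {v \<in> K. N v = 1}" for v'
  proof -
    from that have v': "v' \<in> K" "N v' = 1" by auto
    obtain t where t: "?G v' = ereal t"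
      "\<And>y s. y \<in> L \<Longrightarrow> N y \<le> 1 \<Longrightarrow> y - s *\<^sub>R v' \<in> K \<Longrightarrow> s \<le> t"
      using inner_max_attained[OF v'] by blast
    have "\<exists>u' w'. (v', u', w') \<in> feasible \<and> dual_norm N w' \<le> t"
      by (rule strong_duality[OF v']) (rule t(2))
    then obtain u' w' where "(v', u', w') \<in> feasible" "dual_norm N w' \<le> t" by blast
    then show ?thesis using min[of v' u' w'] t(1) by simp
  qed
  obtain t x where t: "?G v = ereal t" "x \<in> L" "N x \<le> 1" "x - t *\<^sub>R v \<in> K"
    using inner_max_attained[OF v] by blast
  have "t \<le> dual_norm N w" using weak_duality[OF t(2-4)] z by (auto simp: feasible_def)
  then have "?G v = ereal (dual_norm N w)" using ge[of v] v t(1) by simp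
  moreover have "sigma_measure N K L = ?G v"
    unfolding sigma_measure_def using v ge calculation by (intro min_on_eqI) auto
  ultimately show ?thesis using z min by auto
qed

text \<open>The triangle inequality bounds \<open>y\<close> on sublevel sets, as \<open>u\<close>
  has dual norm 1. Positivity makes the quotient by nu meaningful.\<close>

lemma nu_measure_attained:
  "\<exists>u\<in>dual_cone K. \<exists>y\<in>L\<^sup>\<bottom>. dual_norm N u = 1 \<and> nu_measure N K L = dual_norm N (u - y) \<and>
    0 < dual_norm N (u - y) \<and>
    (\<forall>u'\<in>dual_cone K. \<forall>y'\<in>L\<^sup>\<bottom>. dual_norm N u' = 1 \<longrightarrow> dual_norm N (u - y) \<le> dual_norm N (u' - y'))"
proof -
  let ?D = "{(u, y). u \<in> dual_cone K \<and> y \<in> L\<^sup>\<bottom> \<and> dual_norm N u = 1}"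
  let ?g = "\<lambda>(u, y). dual_norm N (u - y)"
  have D: "?D = {u \<in> dual_cone K. dual_norm N u = 1} \<times> (L\<^sup>\<bottom>)" by auto
  have "closed ?D"
    unfolding D by (intro closed_Times compact_imp_closed[OF dual_sphere_compact]
        closed_subspace[OF subspace_orthogonal_comp])
  moreover have "?D \<noteq> {}"
    using dual_sphere_nonempty subspace_0[OF subspace_orthogonal_comp, of L] unfolding D by blast
  moreover have "continuous_on UNIV ?g"
    unfolding case_prod_unfold
    by (intro continuous_on_compose2[OF is_norm_continuous[OF norm_D]] continuous_intros) auto
  moreover have "bounded {z \<in> ?D. ?g z \<le> c}" for c
  proof -
    have "{z \<in> ?D. ?g z \<le> c}
        \<subseteq> {u \<in> dual_cone K. dual_norm N u = 1} \<times> {y. dual_norm N y \<le> 1 + c}"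
    proof safe
      fix u y assume *: "dual_norm N u = 1" "dual_norm N (u - y) \<le> c"
      have "dual_norm N y \<le> dual_norm N u + dual_norm N (- (u - y))"
        using is_norm_triangle[OF norm_D, of u "- (u - y)"] by simp
      then show "dual_norm N y \<le> 1 + c"
        using * is_norm_scaleR[OF norm_D, of "-1" "u - y"] by simp
    qed
    moreover have "bounded ({u \<in> dual_cone K. dual_norm N u = 1} \<times> {y. dual_norm N y \<le> 1 + c})"
      by (intro bounded_Times compact_imp_bounded[OF dual_sphere_compact] is_norm_bounded[OF norm_D])
    ultimately show ?thesis by (rule bounded_subset[rotated])
  qed
  ultimately have "\<exists>z\<in>?D. min_on ?D ?g = ?g z \<and> (\<forall>z'\<in>?D. ?g z \<le> ?g z')"
    by (rule min_on_attained)
  then obtain z where z: "z \<in> ?D" "min_on ?D ?g = ?g z" "\<And>z'. z' \<in> ?D \<Longrightarrow> ?g z \<le> ?g z'" by blast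
  obtain u y where uy: "z = (u, y)" by (cases z)
  have u: "u \<in> dual_cone K" "y \<in> L\<^sup>\<bottom>" "dual_norm N u = 1" using z(1) uy by auto
  \<comment> \<open>Otherwise \<open>u\<close> would be orthogonal to \<open>L\<close> and vanish at
    the interior point \<open>p\<close>.\<close>
  have "u - y \<noteq> 0"
  proof
    assume "u - y = 0"
    then have "u \<bullet> p = 0" using u(2) pL by (simp add: mem_orthogonal_comp_iff)
    moreover have "u \<noteq> 0" using u(3) is_norm_eq_0_iff[OF norm_D, of u] by auto
    ultimately show False using inner_interior_dual_cone_pos[OF reg pK u(1)] by simp
  qed
  then have "0 < dual_norm N (u - y)" by (rule is_norm_pos[OF norm_D])
  moreover have "dual_norm N (u - y) \<le> dual_norm N (u' - y')"
    if "u' \<in> dual_cone K" "y' \<in> L\<^sup>\<bottom>" "dual_norm N u' = 1" for u' y'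
    using z(3)[of "(u', y')"] that uy by simp
  moreover have "nu_measure N K L = dual_norm N (u - y)"
    using z(2) uy by (simp add: nu_measure_def)
  ultimately show ?thesis using u by blast
qed

subsection \<open>Comparison of the two measures\<close>

abbreviation cone_max :: "'a \<Rightarrow> real" where
  "cone_max u \<equiv> max_on {v \<in> K. N v = 1} (\<lambda>v. u \<bullet> v)"

lemma cone_max_ge: "v \<in> K \<Longrightarrow> N v = 1 \<Longrightarrow> u \<bullet> v \<le> cone_max u"
  by (intro support_ge cone_sphere_compact) simp

lemma cone_max_attained: "\<exists>v\<in>K. N v = 1 \<and> cone_max u = u \<bullet> v"
  using support_attained[OF cone_sphere_compact cone_sphere_nonempty, of u] by blast

text \<open>The normalised interior point is a competitor with positive value; this keeps the
  reciprocals in the upper bound from dividing by zero.\<close>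

lemma cone_max_pos:
  assumes "u \<in> dual_cone K" "u \<noteq> 0"
  shows "0 < cone_max u"
proof -
  have p: "p \<in> K" "p \<noteq> 0"
    using pK interior_subset interior_regular_cone_nonzero[OF reg] by auto
  have Np: "0 < N p" using p(2) by (rule is_norm_pos[OF norm_N])
  have "0 < u \<bullet> ((1 / N p) *\<^sub>R p)" using inner_interior_dual_cone_pos[OF reg pK assms] Np by simp
  also have "\<dots> \<le> cone_max u"
    using p Np by (intro cone_max_ge regular_cone_scaleR[OF reg] is_norm_normalize[OF norm_N]) auto
  finally show ?thesis .
qed

lemma min_cone_max_attained:
  "\<exists>u\<in>dual_cone K. dual_norm N u = 1 \<and>
    min_on {u \<in> dual_cone K. dual_norm N u = 1} cone_max = cone_max u \<and> 0 < cone_max u \<and>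
    (\<forall>u'\<in>dual_cone K. dual_norm N u' = 1 \<longrightarrow> cone_max u \<le> cone_max u')"
proof -
  let ?S = "{u \<in> dual_cone K. dual_norm N u = 1}"
  have "bounded {u \<in> ?S. cone_max u \<le> c}" for c
    by (rule bounded_subset[OF compact_imp_bounded[OF dual_sphere_compact]]) auto
  then have "\<exists>u\<in>?S. min_on ?S cone_max = cone_max u \<and> (\<forall>u'\<in>?S. cone_max u \<le> cone_max u')"
    by (intro min_on_attained compact_imp_closed[OF dual_sphere_compact] dual_sphere_nonempty
        continuous_on_support cone_sphere_compact cone_sphere_nonempty)
  then obtain u where u: "u \<in> ?S" "min_on ?S cone_max = cone_max u"
    "\<forall>u'\<in>?S. cone_max u \<le> cone_max u'" by blast
  have "u \<noteq> 0" using u(1) is_norm_eq_0_iff[OF norm_D, of u] by auto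
  then have "0 < cone_max u" using u(1) by (intro cone_max_pos) auto
  then show ?thesis using u by (intro bexI[of _ u]) auto
qed

abbreviation min_dual_norm :: real where
  "min_dual_norm \<equiv>
    min_on {(v, u). v \<in> K \<and> u \<in> dual_cone K \<and> N v = 1 \<and> u \<bullet> v = 1} (\<lambda>(v, u). dual_norm N u)"

lemma min_dual_norm_attained:
  "\<exists>v u. v \<in> K \<and> u \<in> dual_cone K \<and> N v = 1 \<and> u \<bullet> v = 1 \<and>
    min_dual_norm = dual_norm N u \<and>
    (\<forall>v' u'. v' \<in> K \<longrightarrow> u' \<in> dual_cone K \<longrightarrow> N v' = 1 \<longrightarrow> u' \<bullet> v' = 1 \<longrightarrow>
      dual_norm N u \<le> dual_norm N u')"
proof -
  let ?S = "{(v, u). v \<in> K \<and> u \<in> dual_cone K \<and> N v = 1 \<and> u \<bullet> v = 1}"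
  let ?g = "\<lambda>(v, u). dual_norm N u"
  have "?S = {v \<in> K. N v = 1} \<times> dual_cone K \<inter> {z. snd z \<bullet> fst z = 1}" by auto
  moreover have "closed \<dots>"
    by (intro closed_Int closed_Times closed_Collect_eq compact_imp_closed[OF cone_sphere_compact]
        closed_dual_cone continuous_intros)
  ultimately have "closed ?S" by simp
  moreover have "?S \<noteq> {}"
    using cone_sphere_nonempty feasible_exists unfolding feasible_def by blast
  moreover have "continuous_on UNIV ?g"
    unfolding case_prod_unfold
    by (intro continuous_on_compose2[OF is_norm_continuous[OF norm_D]] continuous_intros) auto
  moreover have "bounded {z \<in> ?S. ?g z \<le> c}" for c
  proof -
    have "bounded ({v \<in> K. N v = 1} \<times> {u. dual_norm N u \<le> c})"
      by (intro bounded_Times compact_imp_bounded[OF cone_sphere_compact] is_norm_bounded[OF norm_D])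
    then show ?thesis by (rule bounded_subset) auto
  qed
  ultimately have "\<exists>z\<in>?S. min_on ?S ?g = ?g z \<and> (\<forall>z'\<in>?S. ?g z \<le> ?g z')"
    by (rule min_on_attained)
  then obtain z where z: "z \<in> ?S" "min_on ?S ?g = ?g z" "\<And>z'. z' \<in> ?S \<Longrightarrow> ?g z \<le> ?g z'" by blast
  obtain v u where vu: "z = (v, u)" by (cases z)
  have "dual_norm N u \<le> dual_norm N u'"
    if "v' \<in> K" "u' \<in> dual_cone K" "N v' = 1" "u' \<bullet> v' = 1" for v' u'
    using z(3)[of "(v', u')"] that vu by simp
  then show ?thesis using z(1,2) vu by (intro exI[of _ v] exI[of _ u]) simp
qed

text \<open>Each minimiser is rescaled into a competitor for the other problem: that of sigma by the
  dual norm of its \<open>u\<close>, that of nu by the cone maximum of its \<open>a\<close>. The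
  real witness \<open>s\<close> keeps the arithmetic outside \<open>ereal\<close>.\<close>

lemma sigma_nu_bounds:
  "\<exists>s. sigma_measure N K L = ereal s \<and> 0 < nu_measure N K L \<and>
    1 \<le> min_dual_norm \<and>
    min_dual_norm
      \<le> s / nu_measure N K L \<and>
    s / nu_measure N K L \<le> 1 / min_on {u \<in> dual_cone K. dual_norm N u = 1} cone_max"
proof -
  obtain v u w where vuw: "(v, u, w) \<in> feasible" and sigma: "sigma_measure N K L = ereal (dual_norm N w)"
    and sigma_min: "\<And>v' u' w'. (v', u', w') \<in> feasible \<Longrightarrow> dual_norm N w \<le> dual_norm N w'"
    using sigma_measure_attained by blast
  obtain a y where a: "a \<in> dual_cone K" "y \<in> L\<^sup>\<bottom>" "dual_norm N a = 1"
    and nu: "nu_measure N K L = dual_norm N (a - y)" and nu_pos: "0 < dual_norm N (a - y)"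
    and nu_min: "\<And>u' y'. u' \<in> dual_cone K \<Longrightarrow> y' \<in> L\<^sup>\<bottom> \<Longrightarrow> dual_norm N u' = 1 \<Longrightarrow>
      dual_norm N (a - y) \<le> dual_norm N (u' - y')"
    using nu_measure_attained by blast
  obtain v0 u0 where 0: "N v0 = 1" "u0 \<bullet> v0 = 1" and m: "min_dual_norm = dual_norm N u0"
    and m_min: "\<And>v' u'. v' \<in> K \<Longrightarrow> u' \<in> dual_cone K \<Longrightarrow> N v' = 1 \<Longrightarrow> u' \<bullet> v' = 1 \<Longrightarrow>
      dual_norm N u0 \<le> dual_norm N u'"
    using min_dual_norm_attained by blast
  have "1 \<le> min_dual_norm" using inner_le_dual_norm[OF norm_N, of u0 v0] 0 m by simp
  moreover have "min_dual_norm \<le> dual_norm N w / dual_norm N (a - y)"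
  proof -
    have u: "u \<in> dual_cone K" "u - w \<in> L\<^sup>\<bottom>" "u \<noteq> 0" using vuw by (auto simp: feasible_def)
    have pos: "0 < dual_norm N u" using u(3) by (rule is_norm_pos[OF norm_D])
    \<comment> \<open>Scaling both \<open>u\<close> and the orthogonal part \<open>u - w\<close>
      makes the pair admissible for nu and leaves the scaled \<open>w\<close> as the
      difference.\<close>
    let ?c = "1 / dual_norm N u"
    have "dual_norm N (a - y) \<le> dual_norm N (?c *\<^sub>R u - ?c *\<^sub>R (u - w))"
      using u pos by (intro nu_min dual_cone_scaleR subspace_scale[OF subspace_orthogonal_comp]
          is_norm_normalize[OF norm_D]) auto
    also have "?c *\<^sub>R u - ?c *\<^sub>R (u - w) = ?c *\<^sub>R w" by (simp add: algebra_simps)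
    also have "dual_norm N \<dots> = dual_norm N w / dual_norm N u"
      using pos by (simp add: is_norm_scaleR[OF norm_D])
    finally have "dual_norm N u \<le> dual_norm N w / dual_norm N (a - y)"
      using pos nu_pos by (simp add: field_simps)
    moreover have "min_dual_norm \<le> dual_norm N u"
      using m m_min[of v u] vuw by (auto simp: feasible_def)
    ultimately show ?thesis by linarith
  qed
  moreover have "dual_norm N w / dual_norm N (a - y)
      \<le> 1 / min_on {u \<in> dual_cone K. dual_norm N u = 1} cone_max"
  proof -
    obtain b where b: "min_on {u \<in> dual_cone K. dual_norm N u = 1} cone_max = cone_max b"
      "0 < cone_max b" "cone_max b \<le> cone_max a"
      using min_cone_max_attained a by blast
    \<comment> \<open>Taking a maximiser \<open>q\<close> of \<open>a\<close> as the vector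
      \<open>v\<close> makes the normalising factor \<open>1 / (a \<bullet> q)\<close> as small as
      possible; the worst case over \<open>a\<close> is \<open>b\<close>.\<close>
    obtain q where q: "q \<in> K" "N q = 1" "cone_max a = a \<bullet> q" using cone_max_attained by blast
    let ?c = "1 / (a \<bullet> q)"
    have pos: "0 < a \<bullet> q" using b q by simp
    have "(q, ?c *\<^sub>R a, ?c *\<^sub>R (a - y)) \<in> feasible"
      using q(1,2) pos dual_cone_scaleR[OF a(1), of ?c]
        subspace_scale[OF subspace_orthogonal_comp a(2), of ?c]
      by (simp add: feasible_def algebra_simps)
    then have "dual_norm N w \<le> dual_norm N (?c *\<^sub>R (a - y))" by (rule sigma_min)
    also have "\<dots> = dual_norm N (a - y) / (a \<bullet> q)"
      using pos by (simp add: is_norm_scaleR[OF norm_D])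
    finally have "dual_norm N w / dual_norm N (a - y) \<le> 1 / (a \<bullet> q)"
      using nu_pos pos by (simp add: field_simps)
    also have "\<dots> \<le> 1 / cone_max b" using b q by (intro divide_left_mono) auto
    finally show ?thesis using b(1) by simp
  qed
  ultimately show ?thesis using sigma nu nu_pos by auto
qed

lemma sigma_div_nu_bounds:
  "1 \<le> min_dual_norm \<and> ereal min_dual_norm \<le> sigma_measure N K L / ereal (nu_measure N K L) \<and>
    sigma_measure N K L / ereal (nu_measure N K L)
      \<le> ereal (1 / min_on {u \<in> dual_cone K. dual_norm N u = 1} cone_max)"
proof -
  obtain s where s: "sigma_measure N K L = ereal s" "0 < nu_measure N K L" and bounds:
    "1 \<le> min_dual_norm" "min_dual_norm \<le> s / nu_measure N K L"
    "s / nu_measure N K L \<le> 1 / min_on {u \<in> dual_cone K. dual_norm N u = 1} cone_max"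
    using sigma_nu_bounds by blast
  have "sigma_measure N K L / ereal (nu_measure N K L) = ereal (s / nu_measure N K L)"
    using s by simp
  then show ?thesis using bounds by simp
qed

text \<open>The hypothesis makes the upper bound on the quotient at most 1, and the lower bounds
  make the quotient at least 1.\<close>

lemma sigma_eq_nu:
  assumes "\<And>u. u \<in> dual_cone K \<Longrightarrow> dual_norm N u = 1 \<Longrightarrow> 1 \<le> cone_max u"
  shows "sigma_measure N K L = ereal (nu_measure N K L)"
proof -
  obtain s where s: "sigma_measure N K L = ereal s" "0 < nu_measure N K L"
    "1 \<le> min_dual_norm" "min_dual_norm \<le> s / nu_measure N K L"
    "s / nu_measure N K L \<le> 1 / min_on {u \<in> dual_cone K. dual_norm N u = 1} cone_max"
    using sigma_nu_bounds by blast
  obtain u where "u \<in> dual_cone K" "dual_norm N u = 1"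
    "min_on {u \<in> dual_cone K. dual_norm N u = 1} cone_max = cone_max u"
    using min_cone_max_attained by blast
  then have "1 / min_on {u \<in> dual_cone K. dual_norm N u = 1} cone_max \<le> 1"
    using assms[of u] by simp
  then have "s / nu_measure N K L = 1" using s by linarith
  then show ?thesis using s(1,2) by (simp add: field_simps)
qed

end

subsection \<open>The Euclidean norm\<close>

text \<open>Since \<open>arccos\<close> is decreasing, the smallest angle between \<open>u\<close>
  and \<open>K\<close> is the \<open>arccos\<close> of \<open>cone_max u / norm u\<close>, and the
  largest such angle belongs to a unit \<open>u\<close> with the smallest
  \<open>cone_max\<close>.\<close>

lemma cos_max_min_angle:
  fixes K L :: "'a::euclidean_space set" and p :: 'a
  assumes "subspace_meeting_cone K L norm p"
  shows "cos (max_min_angle (dual_cone K) K)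
    = min_on {u \<in> dual_cone K. norm u = 1} (\<lambda>u. max_on {v \<in> K. norm v = 1} (\<lambda>v. u \<bullet> v))"
proof -
  interpret subspace_meeting_cone K L norm p by fact
  obtain b where b: "b \<in> dual_cone K" "norm b = 1" "0 < cone_max b"
    "min_on {u \<in> dual_cone K. norm u = 1} cone_max = cone_max b"
    "\<And>u. u \<in> dual_cone K \<Longrightarrow> norm u = 1 \<Longrightarrow> cone_max b \<le> cone_max u"
    using min_cone_max_attained unfolding dual_norm_norm by blast
  \<comment> \<open>Together with nonnegativity on the dual cone this keeps arguments in the range
    where \<open>arccos\<close> is monotone; for \<open>u = 0\<close> the quotient is 0 by
    convention.\<close>
  have le: "cone_max u / norm u \<le> 1" for u
  proof -
    obtain v where "norm v = 1" "cone_max u = u \<bullet> v" using cone_max_attained by blast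
    then show ?thesis
      using norm_cauchy_schwarz[of u v] by (cases "u = 0") (simp_all add: field_simps)
  qed
  have min: "min_on (K - {0}) (angle u) = arccos (cone_max u / norm u)"
    if u: "u \<in> dual_cone K" "u \<noteq> 0" for u
  proof -
    obtain v where v: "v \<in> K" "norm v = 1" "cone_max u = u \<bullet> v" using cone_max_attained by blast
    have angle_v: "angle u v = arccos (cone_max u / norm u)" using v by (simp add: angle_def)
    have "angle u v \<le> angle u y" if y: "y \<in> K - {0}" for y
    proof -
      have "u \<bullet> ((1 / norm y) *\<^sub>R y) \<le> cone_max u"
        using y by (intro cone_max_ge regular_cone_scaleR[OF reg]) auto
      then have "(u \<bullet> y) / (norm u * norm y) \<le> cone_max u / norm u"
        using y u(2) by (simp add: field_simps)
      moreover have "0 \<le> (u \<bullet> y) / (norm u * norm y)"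
        using u(1) y inner_dual_cone_nonneg[of u K y] by simp
      ultimately show ?thesis
        unfolding angle_v using le[of u] by (simp add: angle_def arccos_le_arccos)
    qed
    then have "min_on (K - {0}) (angle u) = angle u v" using v by (intro min_on_eqI) auto
    then show ?thesis using angle_v by simp
  qed
  have "max_on (dual_cone K - {0}) (\<lambda>u. min_on (K - {0}) (angle u)) = min_on (K - {0}) (angle b)"
  proof (rule max_on_eqI)
    show "b \<in> dual_cone K - {0}" using b by auto
    fix u assume "u \<in> dual_cone K - {0}"
    then have u: "u \<in> dual_cone K" "u \<noteq> 0" by auto
    \<comment> \<open>The minimality of \<open>b\<close> is among unit vectors, so \<open>u\<close>
      is normalised first and the factor is pulled out of the maximum afterwards.\<close>
    have "cone_max b \<le> cone_max ((1 / norm u) *\<^sub>R u)"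
      using u by (intro b(5) dual_cone_scaleR) auto
    moreover obtain v where "v \<in> K" "norm v = 1"
      "cone_max ((1 / norm u) *\<^sub>R u) = (1 / norm u) *\<^sub>R u \<bullet> v" using cone_max_attained by blast
    moreover from this have "(1 / norm u) *\<^sub>R u \<bullet> v \<le> cone_max u / norm u"
      using cone_max_ge[of v u] by (simp add: divide_right_mono)
    ultimately have "cone_max b \<le> cone_max u / norm u" by linarith
    then have "arccos (cone_max u / norm u) \<le> arccos (cone_max b / norm b)"
      using b le[of u] by (intro arccos_le_arccos) auto
    then show "min_on (K - {0}) (angle u) \<le> min_on (K - {0}) (angle b)"
      using min[OF u] min[of b] b by force
  qed
  moreover have "b \<noteq> 0" using b(2) by auto
  ultimately have "max_min_angle (dual_cone K) K = arccos (cone_max b)"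
    unfolding max_min_angle_def using min[OF b(1)] b(2) by simp
  then show ?thesis using b le[of b] by (simp add: cos_arccos)
qed

subsection \<open>The order unit norm\<close>

context
  fixes K :: "'a::euclidean_space set" and e :: 'a
  assumes reg: "regular_cone K" and e: "e \<in> interior K"
begin

lemma order_unit_in_cone: "e \<in> K"
  using e interior_subset by blast

text \<open>The set of admissible \<open>\<alpha>\<close> is nonempty, closed and bounded below, so
  its minimum exists, and it is upward closed because \<open>e\<close> is in \<open>K\<close>. Later
  facts on this norm rest on this equivalence instead of \<open>LEAST\<close>.\<close>

lemma order_unit_norm_le_iff:
  "order_unit_norm K e x \<le> \<alpha> \<longleftrightarrow> 0 \<le> \<alpha> \<and> x + \<alpha> *\<^sub>R e \<in> K \<and> - x + \<alpha> *\<^sub>R e \<in> K"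
proof -
  let ?S = "{\<alpha>. 0 \<le> \<alpha> \<and> x + \<alpha> *\<^sub>R e \<in> K \<and> - x + \<alpha> *\<^sub>R e \<in> K}"
  obtain r where r: "r > 0" "cball e r \<subseteq> K" using e mem_interior_cball by blast
  have "?S \<noteq> {}"
  proof (cases "x = 0")
    case True
    then have "0 \<in> ?S" using regular_cone_zero[OF reg] by simp
    then show ?thesis by blast
  next
    case False
    \<comment> \<open>Adding or subtracting \<open>(1 / ?c) *\<^sub>R x\<close> moves
      \<open>e\<close> by exactly the distance \<open>r\<close>, hence within the closed ball
      contained in \<open>K\<close>.\<close>
    let ?c = "norm x / r"
    have "e + (1 / ?c) *\<^sub>R x \<in> K" "e - (1 / ?c) *\<^sub>R x \<in> K"
      using False r by (auto intro!: subsetD[OF r(2)] simp: dist_norm)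
    then have "?c *\<^sub>R (e + (1 / ?c) *\<^sub>R x) \<in> K" "?c *\<^sub>R (e - (1 / ?c) *\<^sub>R x) \<in> K"
      using r by (auto intro!: regular_cone_scaleR[OF reg])
    then have "?c \<in> ?S" using False r by (simp add: algebra_simps)
    then show ?thesis by blast
  qed
  moreover have "?S = {0..} \<inter> (\<lambda>\<alpha>. x + \<alpha> *\<^sub>R e) -` K \<inter> (\<lambda>\<alpha>. - x + \<alpha> *\<^sub>R e) -` K" by auto
  moreover have "closed \<dots>"
    by (intro closed_Int closed_vimage closed_atLeast regular_cone_closed[OF reg] continuous_intros)
  moreover have bdd: "bdd_below ?S" by (rule bdd_belowI[of _ 0]) auto
  ultimately have "Inf ?S \<in> ?S" by (metis (lifting) closed_contains_Inf)
  then obtain m where m: "m = Inf ?S" "0 \<le> m" "x + m *\<^sub>R e \<in> K" "- x + m *\<^sub>R e \<in> K" by blast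
  have lower: "m \<le> s" if "0 \<le> s" "x + s *\<^sub>R e \<in> K" "- x + s *\<^sub>R e \<in> K" for s
    unfolding m(1) using that bdd by (intro cInf_lower) simp_all
  have eq: "order_unit_norm K e x = m"
    unfolding order_unit_norm_def by (rule Least_equality) (use m lower in blast)+
  show ?thesis
  proof
    assume le: "order_unit_norm K e x \<le> \<alpha>"
    have "y + \<alpha> *\<^sub>R e \<in> K" if "y + m *\<^sub>R e \<in> K" for y
    proof -
      have "(\<alpha> - m) *\<^sub>R e \<in> K"
        using le eq order_unit_in_cone by (intro regular_cone_scaleR[OF reg]) simp_all
      with that have "(y + m *\<^sub>R e) + (\<alpha> - m) *\<^sub>R e \<in> K" by (rule regular_cone_add[OF reg])
      then show ?thesis by (simp add: algebra_simps)
    qed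
    then show "0 \<le> \<alpha> \<and> x + \<alpha> *\<^sub>R e \<in> K \<and> - x + \<alpha> *\<^sub>R e \<in> K"
      using m(2-4) le eq order_trans[of 0 m \<alpha>] by blast
  next
    assume "0 \<le> \<alpha> \<and> x + \<alpha> *\<^sub>R e \<in> K \<and> - x + \<alpha> *\<^sub>R e \<in> K"
    then show "order_unit_norm K e x \<le> \<alpha>" using lower[of \<alpha>] eq by blast
  qed
qed

lemma order_unit_normD:
  "0 \<le> order_unit_norm K e x" "x + order_unit_norm K e x *\<^sub>R e \<in> K"
  "- x + order_unit_norm K e x *\<^sub>R e \<in> K"
  using order_unit_norm_le_iff[of x "order_unit_norm K e x"] by auto

lemma is_norm_order_unit_norm: "is_norm (order_unit_norm K e)"
proof -
  let ?n = "order_unit_norm K e"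
  have zero: "?n x = 0 \<longleftrightarrow> x = 0" for x
  proof
    assume "?n x = 0"
    then show "x = 0" using order_unit_normD[of x] regular_cone_pointed[OF reg, of x] by simp
  next
    assume "x = 0"
    then have "?n x \<le> 0" using order_unit_norm_le_iff[of x 0] regular_cone_zero[OF reg] by simp
    then show "?n x = 0" using order_unit_normD(1)[of x] by linarith
  qed
  have scale_le: "?n (a *\<^sub>R x) \<le> \<bar>a\<bar> * ?n x" for a x
  proof -
    have "\<bar>a\<bar> *\<^sub>R (x + ?n x *\<^sub>R e) \<in> K" "\<bar>a\<bar> *\<^sub>R (- x + ?n x *\<^sub>R e) \<in> K"
      using order_unit_normD[of x] by (auto intro!: regular_cone_scaleR[OF reg])
    then show ?thesis
      unfolding order_unit_norm_le_iff using order_unit_normD(1)[of x]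
      by (cases "0 \<le> a") (simp_all add: algebra_simps mult_nonpos_nonneg)
  qed
  have scale: "?n (a *\<^sub>R x) = \<bar>a\<bar> * ?n x" for a x
  proof (cases "a = 0")
    case True
    then show ?thesis using zero[of 0] by simp
  next
    case False
    \<comment> \<open>The reverse inequality is \<open>scale_le\<close> for the factor
      \<open>1 / a\<close> and the vector \<open>a *\<^sub>R x\<close>.\<close>
    have "?n x \<le> \<bar>1 / a\<bar> * ?n (a *\<^sub>R x)" using scale_le[of "1 / a" "a *\<^sub>R x"] False by simp
    then have "\<bar>a\<bar> * ?n x \<le> ?n (a *\<^sub>R x)" using False by (simp add: field_simps)
    then show ?thesis using scale_le[of a x] by linarith
  qed
  have "?n (x + y) \<le> ?n x + ?n y" for x y
  proof -
    have "(x + ?n x *\<^sub>R e) + (y + ?n y *\<^sub>R e) \<in> K" "(- x + ?n x *\<^sub>R e) + (- y + ?n y *\<^sub>R e) \<in> K"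
      using order_unit_normD[of x] order_unit_normD[of y]
      by (auto intro!: regular_cone_add[OF reg])
    then show ?thesis
      unfolding order_unit_norm_le_iff using order_unit_normD(1)[of x] order_unit_normD(1)[of y]
      by (simp add: algebra_simps)
  qed
  then show ?thesis unfolding is_norm_def using zero scale order_unit_normD(1) by blast
qed

text \<open>Puts \<open>e\<close> among the unit vectors of \<open>K\<close>. A value below 1 would
  place a positive multiple of \<open>- e\<close> in \<open>K\<close>, against pointedness.\<close>

lemma order_unit_norm_unit: "order_unit_norm K e e = 1"
proof -
  have "order_unit_norm K e e \<le> 1"
    using regular_cone_add[OF reg order_unit_in_cone order_unit_in_cone] regular_cone_zero[OF reg]
    by (simp add: order_unit_norm_le_iff)
  moreover have "\<not> order_unit_norm K e e < 1"
  proof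
    let ?t = "order_unit_norm K e e"
    assume less: "?t < 1"
    have "(1 / (1 - ?t)) *\<^sub>R (- e + ?t *\<^sub>R e) \<in> K"
      using less order_unit_normD(3)[of e] by (intro regular_cone_scaleR[OF reg]) auto
    also have "- e + ?t *\<^sub>R e = (1 - ?t) *\<^sub>R (- e)" by (simp add: algebra_simps)
    also have "(1 / (1 - ?t)) *\<^sub>R (1 - ?t) *\<^sub>R (- e) = - e" using less by simp
    finally have "e = 0" using regular_cone_pointed[OF reg order_unit_in_cone] by simp
    then show False using interior_regular_cone_nonzero[OF reg e] by simp
  qed
  ultimately show ?thesis by simp
qed

text \<open>A unit vector \<open>x\<close> satisfies \<open>e - x \<in> K\<close>, so
  \<open>u\<close> is at most as large at \<open>x\<close> as at \<open>e\<close>.\<close>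

lemma dual_order_unit_norm_le:
  assumes "u \<in> dual_cone K"
  shows "dual_norm (order_unit_norm K e) u \<le> u \<bullet> e"
proof -
  obtain x where x: "order_unit_norm K e x = 1" "dual_norm (order_unit_norm K e) u = u \<bullet> x"
    by (rule dual_norm_attained[OF is_norm_order_unit_norm])
  have "- x + 1 *\<^sub>R e \<in> K" using order_unit_normD(3)[of x] x(1) by simp
  with assms have "0 \<le> u \<bullet> (- x + 1 *\<^sub>R e)" by (rule inner_dual_cone_nonneg)
  then show ?thesis using x(2) by (simp add: inner_diff_right)
qed

end

section \<open>Assembly for general, Euclidean and order unit norms\<close>

theorem proposition5:
  fixes K L :: "'a::euclidean_space set" and e :: 'a
  assumes "regular_cone K" and "e \<in> interior K"
    and "subspace L" and "L \<inter> interior K \<noteq> {}"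
  shows
    "(\<forall>N. is_norm N \<longrightarrow>
        1 \<le> min_on {(v, u). v \<in> K \<and> u \<in> dual_cone K \<and> N v = 1 \<and> u \<bullet> v = 1}
              (\<lambda>(v, u). dual_norm N u) \<and>
        ereal (min_on {(v, u). v \<in> K \<and> u \<in> dual_cone K \<and> N v = 1 \<and> u \<bullet> v = 1}
              (\<lambda>(v, u). dual_norm N u))
          \<le> sigma_measure N K L / ereal (nu_measure N K L) \<and>
        sigma_measure N K L / ereal (nu_measure N K L)
          \<le> ereal (1 / min_on {u \<in> dual_cone K. dual_norm N u = 1}
                        (\<lambda>u. max_on {v \<in> K. N v = 1} (\<lambda>v. u \<bullet> v)))) \<and>
     (1 \<le> sigma_measure norm K L / ereal (nu_measure norm K L) \<and>
      sigma_measure norm K L / ereal (nu_measure norm K L)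
        \<le> ereal (1 / cos (max_min_angle (dual_cone K) K)) \<and>
      (dual_cone K \<subseteq> K \<longrightarrow> ereal (nu_measure norm K L) = sigma_measure norm K L)) \<and>
     sigma_measure (order_unit_norm K e) K L = ereal (nu_measure (order_unit_norm K e) K L)"
proof -
  obtain p where p: "p \<in> L" "p \<in> interior K" using assms(4) by blast
  have loc: "subspace_meeting_cone K L N p" if "is_norm N" for N
    using assms p that by unfold_locales
  note bounds = subspace_meeting_cone.sigma_div_nu_bounds[OF loc]
  note euclid = bounds[OF is_norm_norm]
  have "1 \<le> sigma_measure norm K L / ereal (nu_measure norm K L)"
    by (rule order_trans[OF _ conjunct1[OF conjunct2[OF euclid]]]) (use euclid in simp)
  moreover have "sigma_measure norm K L / ereal (nu_measure norm K L)
      \<le> ereal (1 / cos (max_min_angle (dual_cone K) K))"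
    using euclid unfolding cos_max_min_angle[OF loc[OF is_norm_norm]] dual_norm_norm by blast
  moreover have "sigma_measure norm K L = ereal (nu_measure norm K L)" if sub: "dual_cone K \<subseteq> K"
  proof (rule subspace_meeting_cone.sigma_eq_nu[OF loc[OF is_norm_norm]])
    fix u assume u: "u \<in> dual_cone K" "dual_norm norm u = 1"
    \<comment> \<open>As \<open>dual_cone K \<subseteq> K\<close>, the vector \<open>u\<close> is
      itself a unit vector of \<open>K\<close> and competes in the cone maximum.\<close>
    then have "u \<bullet> u = 1" by (simp add: dual_norm_norm dot_square_norm)
    then show "1 \<le> max_on {v \<in> K. norm v = 1} (\<lambda>v. u \<bullet> v)"
      using subspace_meeting_cone.cone_max_ge[OF loc[OF is_norm_norm], of u u] u sub
      by (auto simp: dual_norm_norm)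
  qed
  moreover have "sigma_measure (order_unit_norm K e) K L = ereal (nu_measure (order_unit_norm K e) K L)"
  proof (rule subspace_meeting_cone.sigma_eq_nu)
    show loc_e: "subspace_meeting_cone K L (order_unit_norm K e) p"
      by (rule loc[OF is_norm_order_unit_norm[OF assms(1,2)]])
    fix u assume u: "u \<in> dual_cone K" "dual_norm (order_unit_norm K e) u = 1"
    \<comment> \<open>Here the competitor in the cone maximum is the unit vector \<open>e\<close>,
      whose value bounds the dual norm on the dual cone.\<close>
    have "1 \<le> u \<bullet> e" using dual_order_unit_norm_le[OF assms(1,2) u(1)] u(2) by simp
    also have "\<dots> \<le> max_on {v \<in> K. order_unit_norm K e v = 1} (\<lambda>v. u \<bullet> v)"
      by (intro subspace_meeting_cone.cone_max_ge[OF loc_e] order_unit_in_cone[OF assms(1,2)]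
          order_unit_norm_unit[OF assms(1,2)])
    finally show "1 \<le> max_on {v \<in> K. order_unit_norm K e v = 1} (\<lambda>v. u \<bullet> v)" .
  qed
  ultimately show ?thesis using bounds by auto
qed

end
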